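(* Let $X=(X_1(t),\dots,X_p(t))_{t\in\mathbb{R}}$ be a multivariate fractional Brownian motion with parameter $H=(H_1,\dots,H_p)\in(0,1)^p$, let $i,j\in\{1,\dots,p\}$ and let $\delta>0$. Let $\gamma_{i,j}(h,\delta)=\mathbb{E}\big[(X_i(t+\delta)-X_i(t))(X_j(t+h+\delta)-X_j(t+h))\big]$ be the cross-covariance of the increments of size $\delta$ (which does not depend on $t$). Then, as $|h|\to+\infty$, $$\gamma_{i,j}(h,\delta)\sim \frac{\sigma_i\sigma_j}{2}\,\delta^2\,|h|^{H_i+H_j-2}\,\kappa_{i,j}(\mathrm{sign}(h)),$$ where $$\kappa_{i,j}(\mathrm{sign}(h))=\begin{cases}(\rho_{i,j}-\eta_{i,j}\,\mathrm{sign}(h))(H_i+H_j)(H_i+H_j-1) & \text{if } H_i+H_j\neq 1,\\ \tilde\eta_{i,j}\,\mathrm{sign}(h) & \text{if } H_i+H_j=1.\end{cases}$$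
   Context: A multivariate fractional Brownian motion (mfBm) with parameter $H\in(0,1)^p$ is an $\mathbb{R}^p$-valued Gaussian process $(X(t))_{t\in\mathbb{R}}$ with stationary increments that is self-similar with parameter $H$: for every $\lambda>0$, $(X_1(\lambda t),\dots,X_p(\lambda t))_{t\in\mathbb{R}}$ and $(\lambda^{H_1}X_1(t),\dots,\lambda^{H_p}X_p(t))_{t\in\mathbb{R}}$ have the same finite-dimensional distributions. Write $\sigma_i^2=\mathrm{var}(X_i(1))$, $\sigma_i>0$. The parameters $\rho_{i,j},\eta_{i,j},\tilde\rho_{i,j},\tilde\eta_{i,j}$ are the real numbers in the following known form of the covariances of the mfBm: for all $i,j$ and $s,t\in\mathbb{R}$, - if $H_i+H_j\ne1$, with $\rho_{i,j}=\rho_{j,i}=\mathrm{corr}(X_i(1),X_j(1))\in[-1,1]$ and $\eta_{i,j}=-\eta_{j,i}\in\mathbb{R}$, $$\mathbb{E}X_i(s)X_j(t)=\tfrac{\sigma_i\sigma_j}{2}\big\{(\rho_{i,j}+\eta_{i,j}\mathrm{sign}(s))|s|^{H_i+H_j}+(\rho_{i,j}-\eta_{i,j}\mathrm{sign}(t))|t|^{H_i+H_j}-(\rho_{i,j}-\eta_{i,j}\mathrm{sign}(t-s))|t-s|^{H_i+H_j}\big\};$$ - if $H_i+H_j=1$, with $\tilde\rho_{i,j}=\tilde\rho_{j,i}=\mathrm{corr}(X_i(1),X_j(1))\in[-1,1]$ and $\tilde\eta_{i,j}=-\tilde\eta_{j,i}\in\mathbb{R}$, $$\mathbb{E}X_i(s)X_j(t)=\tfrac{\sigma_i\sigma_j}{2}\big\{\tilde\rho_{i,j}(|s|+|t|-|s-t|)+\tilde\eta_{i,j}(t\log|t|-s\log|s|-(t-s)\log|t-s|)\big\}$$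 (with $0\log 0=0$). For $i=j$ one has $\rho_{i,i}=\tilde\rho_{i,i}=1$ and $\eta_{i,i}=\tilde\eta_{i,i}=0$. The relation $f(h)\sim g(h)$ as $|h|\to\infty$ means $f(h)=g(h)(1+o(1))$, as $h\to+\infty$ and as $h\to-\infty$; in particular, if $g$ vanishes for the given sign of $h$, then $f(h)=0$ for $|h|$ large. *)

theory Defs
  imports "HOL-Probability.Probability" "HOL-Library.Landau_Symbols"
begin

text \<open>
  A real random variable is Gaussian in the wide sense: constants are degenerate Gaussians.
  Degenerate laws must be allowed, since a self-similar process vanishes almost surely at time 0.
\<close>

definition gaussian_rv :: "'a measure \<Rightarrow> ('a \<Rightarrow> real) \<Rightarrow> bool" where
  "gaussian_rv M Y \<longleftrightarrow> Y \<in> borel_measurable M \<and>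
     ((\<exists>\<mu>. AE \<omega> in M. Y \<omega> = \<mu>) \<or>
      (\<exists>\<mu> \<sigma>. 0 < \<sigma> \<and> distributed M lborel Y (normal_density \<mu> \<sigma>)))"

text \<open>
  The finite-dimensional distributions are jointly Gaussian iff all finite linear combinations
  of coordinates of the process at finitely many times are Gaussian.
\<close>

definition gaussian_process :: "'a measure \<Rightarrow> (real \<Rightarrow> 'a \<Rightarrow> real ^ 'p) \<Rightarrow> bool" where
  "gaussian_process M X \<longleftrightarrow> (\<forall>t. X t \<in> borel_measurable M) \<and>
     (\<forall>J a. finite J \<longrightarrow> gaussian_rv M (\<lambda>\<omega>. \<Sum>t\<in>J. a t \<bullet> X t \<omega>))"

definition same_fdd ::
  "'a measure \<Rightarrow> (real \<Rightarrow> 'a \<Rightarrow> real ^ 'p) \<Rightarrow> (real \<Rightarrow> 'a \<Rightarrow> real ^ 'p) \<Rightarrow> bool" where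
  "same_fdd M Y Z \<longleftrightarrow> (\<forall>J. finite J \<longrightarrow>
     distr M (Pi\<^sub>M J (\<lambda>_. borel)) (\<lambda>\<omega>. \<lambda>t\<in>J. Y t \<omega>) =
     distr M (Pi\<^sub>M J (\<lambda>_. borel)) (\<lambda>\<omega>. \<lambda>t\<in>J. Z t \<omega>))"

definition stationary_increments :: "'a measure \<Rightarrow> (real \<Rightarrow> 'a \<Rightarrow> real ^ 'p) \<Rightarrow> bool" where
  "stationary_increments M X \<longleftrightarrow>
     (\<forall>u. same_fdd M (\<lambda>t \<omega>. X (t + u) \<omega> - X u \<omega>) (\<lambda>t \<omega>. X t \<omega> - X 0 \<omega>))"

definition self_similar ::
  "'a measure \<Rightarrow> real ^ 'p \<Rightarrow> (real \<Rightarrow> 'a \<Rightarrow> real ^ 'p) \<Rightarrow> bool" where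
  "self_similar M H X \<longleftrightarrow>
     (\<forall>c>0. same_fdd M (\<lambda>t. X (c * t)) (\<lambda>t \<omega>. \<chi> k. c powr (H $ k) * X t \<omega> $ k))"

definition mfBm :: "'a measure \<Rightarrow> real ^ 'p \<Rightarrow> (real \<Rightarrow> 'a \<Rightarrow> real ^ 'p) \<Rightarrow> bool" where
  "mfBm M H X \<longleftrightarrow> prob_space M \<and> (\<forall>k. 0 < H $ k \<and> H $ k < 1) \<and>
     gaussian_process M X \<and> stationary_increments M X \<and> self_similar M H X"

definition std_dev :: "'a measure \<Rightarrow> ('a \<Rightarrow> real) \<Rightarrow> real" where
  "std_dev M Y = sqrt (prob_space.variance M Y)"

definition corr :: "'a measure \<Rightarrow> ('a \<Rightarrow> real) \<Rightarrow> ('a \<Rightarrow> real) \<Rightarrow> real" where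
  "corr M Y Z =
     prob_space.expectation M
       (\<lambda>\<omega>. (Y \<omega> - prob_space.expectation M Y) * (Z \<omega> - prob_space.expectation M Z))
     / (std_dev M Y * std_dev M Z)"

abbreviation mfBm_sd :: "'a measure \<Rightarrow> (real \<Rightarrow> 'a \<Rightarrow> real ^ 'p) \<Rightarrow> 'p \<Rightarrow> real" where
  "mfBm_sd M X k \<equiv> std_dev M (\<lambda>\<omega>. X 1 \<omega> $ k)"

abbreviation mfBm_corr :: "'a measure \<Rightarrow> (real \<Rightarrow> 'a \<Rightarrow> real ^ 'p) \<Rightarrow> 'p \<Rightarrow> 'p \<Rightarrow> real" where
  "mfBm_corr M X k l \<equiv> corr M (\<lambda>\<omega>. X 1 \<omega> $ k) (\<lambda>\<omega>. X 1 \<omega> $ l)"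

text \<open>
  \<open>\<rho>\<close>, \<open>\<eta>\<close> (for \<open>H $ k + H $ l \<noteq> 1\<close>) and \<open>\<rho>'\<close>, \<open>\<eta>'\<close> (for \<open>H $ k + H $ l = 1\<close>) are the
  coefficients in the covariances of \<open>X\<close>; their values at the other index pairs are irrelevant.
  The convention \<open>0 log 0 = 0\<close> is met because a product with factor \<open>0\<close> is \<open>0\<close>.
\<close>

definition mfBm_cov_params ::
  "'a measure \<Rightarrow> real ^ 'p \<Rightarrow> (real \<Rightarrow> 'a \<Rightarrow> real ^ 'p) \<Rightarrow>
   ('p \<Rightarrow> 'p \<Rightarrow> real) \<Rightarrow> ('p \<Rightarrow> 'p \<Rightarrow> real) \<Rightarrow>
   ('p \<Rightarrow> 'p \<Rightarrow> real) \<Rightarrow> ('p \<Rightarrow> 'p \<Rightarrow> real) \<Rightarrow> bool" where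
  "mfBm_cov_params M H X \<rho> \<eta> \<rho>' \<eta>' \<longleftrightarrow>
     (\<forall>k l. H $ k + H $ l \<noteq> 1 \<longrightarrow>
        \<rho> k l = \<rho> l k \<and> \<rho> k l = mfBm_corr M X k l \<and> \<rho> k l \<in> {-1..1} \<and> \<eta> k l = - \<eta> l k \<and>
        (\<forall>s t. prob_space.expectation M (\<lambda>\<omega>. X s \<omega> $ k * X t \<omega> $ l) =
           mfBm_sd M X k * mfBm_sd M X l / 2 *
             ((\<rho> k l + \<eta> k l * sgn s) * \<bar>s\<bar> powr (H $ k + H $ l)
              + (\<rho> k l - \<eta> k l * sgn t) * \<bar>t\<bar> powr (H $ k + H $ l)
              - (\<rho> k l - \<eta> k l * sgn (t - s)) * \<bar>t - s\<bar> powr (H $ k + H $ l)))) \<and>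
     (\<forall>k l. H $ k + H $ l = 1 \<longrightarrow>
        \<rho>' k l = \<rho>' l k \<and> \<rho>' k l = mfBm_corr M X k l \<and> \<rho>' k l \<in> {-1..1} \<and> \<eta>' k l = - \<eta>' l k \<and>
        (\<forall>s t. prob_space.expectation M (\<lambda>\<omega>. X s \<omega> $ k * X t \<omega> $ l) =
           mfBm_sd M X k * mfBm_sd M X l / 2 *
             (\<rho>' k l * (\<bar>s\<bar> + \<bar>t\<bar> - \<bar>s - t\<bar>)
              + \<eta>' k l * (t * ln \<bar>t\<bar> - s * ln \<bar>s\<bar> - (t - s) * ln \<bar>t - s\<bar>))))"

definition incr_cross_cov ::
  "'a measure \<Rightarrow> (real \<Rightarrow> 'a \<Rightarrow> real ^ 'p) \<Rightarrow> 'p \<Rightarrow> 'p \<Rightarrow> real \<Rightarrow> real \<Rightarrow> real \<Rightarrow> real" where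
  "incr_cross_cov M X i j t h \<delta> =
     prob_space.expectation M (\<lambda>\<omega>.
       (X (t + \<delta>) \<omega> $ i - X t \<omega> $ i) * (X (t + h + \<delta>) \<omega> $ j - X (t + h) \<omega> $ j))"

definition kappa ::
  "real ^ 'p \<Rightarrow> ('p \<Rightarrow> 'p \<Rightarrow> real) \<Rightarrow> ('p \<Rightarrow> 'p \<Rightarrow> real) \<Rightarrow> ('p \<Rightarrow> 'p \<Rightarrow> real) \<Rightarrow>
   'p \<Rightarrow> 'p \<Rightarrow> real \<Rightarrow> real" where
  "kappa H \<rho> \<eta> \<eta>' i j \<epsilon> =
     (if H $ i + H $ j \<noteq> 1
      then (\<rho> i j - \<eta> i j * \<epsilon>) * (H $ i + H $ j) * (H $ i + H $ j - 1)
      else \<eta>' i j * \<epsilon>)"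

end

theory Submission
  imports Defs
begin

text \<open>
  With \<open>a = H\<^sub>i + H\<^sub>j\<close>, both forms of the covariance can be written as
  \<open>E X\<^sub>i(s) X\<^sub>j(t) = c (w(-s) + w(t) - w(t - s))\<close> for one kernel \<open>w\<close>, where
  \<open>c = \<sigma>\<^sub>i \<sigma>\<^sub>j / 2\<close>. When the product of two increments is expanded, the terms \<open>w(-s)\<close> and
  \<open>w(t)\<close> cancel and what remains is \<open>c (w(h + \<delta>) + w(h - \<delta>) - 2 w(h))\<close>, which does not contain
  the base time (\<open>incr_cross_cov_eq_second_difference\<close>). The expansion needs the products to be
  integrable, which is where Gaussianity enters: Gaussian variables have second moments.

  A symmetric second difference is \<open>\<delta>\<^sup>2\<close> times a mean of two values of \<open>w''\<close> at distance less than
  \<open>\<delta>\<close> from \<open>h\<close>. On the positive half-line \<open>w''(x) = K x\<^bsup>a-2\<^esup>\<close>: if \<open>a \<noteq> 1\<close>, \<open>w\<close> is a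
  multiple of \<open>x\<^bsup>a\<^esup>\<close>; if \<open>a = 1\<close>, it is a linear term plus a multiple of \<open>x ln x\<close>, whose second
  derivative is \<open>1 / x\<close>. A power function does not change, up to a factor tending to 1, under a
  bounded shift of its argument, so the second difference is equivalent to
  \<open>\<delta>\<^sup>2 K h\<^bsup>a-2\<^esup>\<close> (\<open>second_difference_asymp_equiv\<close>). Reflecting \<open>w\<close> changes the sign of
  \<open>\<eta>\<close>, which yields the behaviour at minus infinity and the factor \<open>sgn h\<close> in \<open>\<kappa>\<close>.
\<close>

section \<open>Second differences\<close>

definition second_difference :: "(real \<Rightarrow> real) \<Rightarrow> real \<Rightarrow> real \<Rightarrow> real" where
  "second_difference f d x = f (x + d) + f (x - d) - 2 * f x"

text \<open>
  Taylor's formula of order two at \<open>0\<close> for \<open>t \<mapsto> f(x + t) + f(x - t) - 2 f(x)\<close>, whose value and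
  first derivative vanish at \<open>0\<close>.
\<close>

lemma second_difference_Taylor:
  fixes f f' f'' :: "real \<Rightarrow> real"
  assumes "d > 0"
    and f: "\<And>y. \<bar>y - x\<bar> \<le> d \<Longrightarrow> (f has_real_derivative f' y) (at y)"
    and f': "\<And>y. \<bar>y - x\<bar> \<le> d \<Longrightarrow> (f' has_real_derivative f'' y) (at y)"
  shows "\<exists>\<tau>. 0 < \<tau> \<and> \<tau> < d \<and>
    second_difference f d x = d\<^sup>2 / 2 * (f'' (x + \<tau>) + f'' (x - \<tau>))"
proof -
  define diff :: "nat \<Rightarrow> real \<Rightarrow> real" where
    "diff n = (if n = 0 then (\<lambda>t. f (x + t) + f (x - t) - 2 * f x)
               else if n = 1 then (\<lambda>t. f' (x + t) - f' (x - t))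
               else (\<lambda>t. f'' (x + t) + f'' (x - t)))" for n
  have "\<forall>m t. m < 2 \<and> 0 \<le> t \<and> t \<le> d \<longrightarrow> DERIV (diff m) t :> diff (Suc m) t"
  proof (intro allI impI)
    fix m :: nat and t assume *: "m < 2 \<and> 0 \<le> t \<and> t \<le> d"
    then have near: "\<bar>(x + t) - x\<bar> \<le> d" "\<bar>(x - t) - x\<bar> \<le> d" by auto
    note f_at = near[THEN f] and f'_at = near[THEN f']
    have inner: "((\<lambda>t. x + t) has_real_derivative 1) (at t)"
        "((\<lambda>t. x - t) has_real_derivative -1) (at t)"
      by (auto intro!: derivative_eq_intros)
    consider "m = 0" | "m = 1" using * by linarith
    then show "DERIV (diff m) t :> diff (Suc m) t"
    proof cases
      case 1
      show ?thesis unfolding 1 diff_def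
        using DERIV_chain2[OF f_at(1) inner(1)] DERIV_chain2[OF f_at(2) inner(2)]
        by (auto intro!: derivative_eq_intros)
    next
      case 2
      show ?thesis unfolding 2 diff_def
        using DERIV_chain2[OF f'_at(1) inner(1)] DERIV_chain2[OF f'_at(2) inner(2)]
        by (auto intro!: derivative_eq_intros)
    qed
  qed
  from Maclaurin[OF \<open>d > 0\<close> _ refl this] obtain \<tau> where
    "0 < \<tau>" "\<tau> < d"
    "diff 0 d = (\<Sum>m<2. diff m 0 / fact m * d ^ m) + diff 2 \<tau> / fact 2 * d\<^sup>2"
    by auto
  then show ?thesis
    by (intro exI[of _ \<tau>])
       (auto simp: diff_def second_difference_def numeral_2_eq_2 algebra_simps)
qed

text \<open>
  The factor \<open>K\<close> is kept out of the limit argument and multiplied in afterwards. Hence \<open>K = 0\<close> is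
  covered: there the equivalence says that the second difference vanishes for large \<open>x\<close>.
\<close>

lemma second_difference_asymp_equiv:
  fixes f f' :: "real \<Rightarrow> real"
  assumes "d > 0"
    and f: "\<And>x. x > 0 \<Longrightarrow> (f has_real_derivative f' x) (at x)"
    and f': "\<And>x. x > 0 \<Longrightarrow> (f' has_real_derivative K * x powr b) (at x)"
  shows "second_difference f d \<sim>[at_top] (\<lambda>x. d\<^sup>2 * x powr b * K)"
proof -
  have "\<exists>\<tau>. 0 < \<tau> \<and> \<tau> < d \<and> second_difference f d x =
      d\<^sup>2 / 2 * (K * (x + \<tau>) powr b + K * (x - \<tau>) powr b)" if "x > d" for x
    by (rule second_difference_Taylor[where f' = f']) (use that assms in auto)
  then obtain \<tau> where \<tau>: "\<And>x. x > d \<Longrightarrow> 0 < \<tau> x \<and> \<tau> x < d \<and> second_difference f d x =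
      d\<^sup>2 / 2 * (K * (x + \<tau> x) powr b + K * (x - \<tau> x) powr b)"
    by metis
  \<comment> \<open>The intermediate points stay within \<open>d\<close> of \<open>x\<close>, so dividing by \<open>x powr b\<close> leaves the \<open>b\<close>-th
    powers of \<open>1 \<plusminus> \<tau> x / x\<close>, which tend to 1.\<close>
  have "((\<lambda>x. \<tau> x / x) \<longlongrightarrow> 0) at_top"
  proof (rule tendsto_sandwich[where f = "\<lambda>_. 0" and h = "\<lambda>x. d / x"])
    show "((\<lambda>x. d / x) \<longlongrightarrow> 0) at_top"
      by (intro tendsto_divide_0[OF tendsto_const] filterlim_at_top_imp_at_infinity filterlim_ident)
    show "\<forall>\<^sub>F x in at_top. 0 \<le> \<tau> x / x"
      using eventually_gt_at_top[of d]
      by eventually_elim (use \<tau> \<open>d > 0\<close> in \<open>auto simp: less_imp_le\<close>)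
    show "\<forall>\<^sub>F x in at_top. \<tau> x / x \<le> d / x"
      using eventually_gt_at_top[of d]
      by eventually_elim (use \<tau> \<open>d > 0\<close> in \<open>auto intro!: divide_right_mono simp: less_imp_le\<close>)
  qed simp
  then have "((\<lambda>x. d\<^sup>2 / 2 * ((1 + \<tau> x / x) powr b + (1 - \<tau> x / x) powr b))
      \<longlongrightarrow> d\<^sup>2 / 2 * ((1 + 0) powr b + (1 - 0) powr b)) at_top"
    by (intro tendsto_intros) auto
  then have "(\<lambda>x. d\<^sup>2 / 2 * ((1 + \<tau> x / x) powr b + (1 - \<tau> x / x) powr b)) \<sim>[at_top] (\<lambda>_. d\<^sup>2)"
    using \<open>d > 0\<close> by (intro tendsto_imp_asymp_equiv_const) auto
  then have "(\<lambda>x. d\<^sup>2 / 2 * ((1 + \<tau> x / x) powr b + (1 - \<tau> x / x) powr b) * (x powr b * K))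
      \<sim>[at_top] (\<lambda>x. d\<^sup>2 * (x powr b * K))"
    by (intro asymp_equiv_mult asymp_equiv_refl)
  moreover have "\<forall>\<^sub>F x in at_top. d\<^sup>2 / 2 * ((1 + \<tau> x / x) powr b + (1 - \<tau> x / x) powr b) * (x powr b * K)
      = second_difference f d x"
    using eventually_gt_at_top[of d]
  proof eventually_elim
    case (elim x)
    have "x + \<tau> x = (1 + \<tau> x / x) * x" "x - \<tau> x = (1 - \<tau> x / x) * x"
      using elim \<open>d > 0\<close> by (auto simp: field_simps)
    moreover have "0 \<le> 1 + \<tau> x / x" "0 \<le> 1 - \<tau> x / x"
      using elim \<tau>[OF elim] \<open>d > 0\<close> by (auto simp: field_simps)
    ultimately have "(x + \<tau> x) powr b = (1 + \<tau> x / x) powr b * x powr b"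
        "(x - \<tau> x) powr b = (1 - \<tau> x / x) powr b * x powr b"
      using elim \<open>d > 0\<close> by (auto simp: powr_mult)
    then show ?case
      using \<tau>[OF elim] by (simp add: algebra_simps)
  qed
  ultimately show ?thesis
    by (rule asymp_equiv_transfer) (simp add: mult.assoc)
qed

section \<open>The covariance kernel\<close>

text \<open>
  \<open>r\<close> and \<open>e\<close> stand for \<open>\<rho>\<close>, \<open>\<eta>\<close> if \<open>a \<noteq> 1\<close> and for \<open>\<rho>'\<close>, \<open>\<eta>'\<close> if \<open>a = 1\<close>.
\<close>

definition cov_kernel :: "real \<Rightarrow> real \<Rightarrow> real \<Rightarrow> real \<Rightarrow> real" where
  "cov_kernel a r e x =
     (if a \<noteq> 1 then (r - e * sgn x) * \<bar>x\<bar> powr a else r * \<bar>x\<bar> + e * (x * ln \<bar>x\<bar>))"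

text \<open>
  The coefficient of \<open>x powr (a - 2)\<close> in the second derivative of the kernel at \<open>x > 0\<close>. At
  \<open>e = \<eta> * sgn h\<close> it is \<open>\<kappa>\<close>.
\<close>

definition cov_kernel_curvature :: "real \<Rightarrow> real \<Rightarrow> real \<Rightarrow> real" where
  "cov_kernel_curvature a r e = (if a \<noteq> 1 then (r - e) * a * (a - 1) else e)"

lemma cov_kernel_minus: "cov_kernel a r e (- x) = cov_kernel a r (- e) x"
  by (simp add: cov_kernel_def sgn_minus)

lemma second_difference_cov_kernel_asymp_equiv_at_top:
  assumes "d > 0"
  shows "second_difference (cov_kernel a r e) d
    \<sim>[at_top] (\<lambda>h. d\<^sup>2 * h powr (a - 2) * cov_kernel_curvature a r e)"
proof (rule second_difference_asymp_equiv[OF assms])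
  define f' where "f' x = (if a \<noteq> 1 then (r - e) * (a * x powr (a - 1)) else r + e * (ln x + 1))" for x
  fix x :: real assume "x > 0"
  define g where "g y = (if a \<noteq> 1 then (r - e) * y powr a else r * y + e * (y * ln y))" for y
  have "(g has_real_derivative f' x) (at x)"
    unfolding g_def f'_def using \<open>x > 0\<close>
    by (auto intro!: derivative_eq_intros simp: field_simps)
  then show "(cov_kernel a r e has_real_derivative f' x) (at x)"
    by (rule has_field_derivative_transform_within_open[where S = "{0<..}"])
       (use \<open>x > 0\<close> in \<open>auto simp: g_def cov_kernel_def\<close>)
  have "x powr (a - 1 - 1) = x powr (a - 2)" by (simp add: algebra_simps)
  then show "(f' has_real_derivative cov_kernel_curvature a r e * x powr (a - 2)) (at x)"
    unfolding f'_def cov_kernel_curvature_def using \<open>x > 0\<close>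
    by (auto intro!: derivative_eq_intros simp: powr_minus divide_simps)
qed

text \<open>
  A second difference is invariant under reflection, so the behaviour at minus infinity is that at
  plus infinity of the reflected kernel, in which \<open>e\<close> has the opposite sign.
\<close>

lemma second_difference_cov_kernel_asymp_equiv:
  assumes "d > 0"
  shows "second_difference (cov_kernel a r e) d
    \<sim>[at_infinity] (\<lambda>h. d\<^sup>2 * \<bar>h\<bar> powr (a - 2) * cov_kernel_curvature a r (e * sgn h))"
    (is "?f \<sim>[_] ?g")
proof -
  have "?f \<sim>[at_top] ?g"
    using second_difference_cov_kernel_asymp_equiv_at_top[OF assms, of a r e]
    by (rule asymp_equiv_transfer)
       (auto intro: eventually_mono[OF eventually_gt_at_top[of 0]])
  moreover have "?f \<sim>[at_bot] ?g"
    unfolding at_bot_mirror asymp_equiv_filtermap_iff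
    using second_difference_cov_kernel_asymp_equiv_at_top[OF assms, of a r "- e"]
  proof (rule asymp_equiv_transfer)
    have "?f (- x) = second_difference (cov_kernel a r (- e)) d x" for x
      using cov_kernel_minus[of a r "- e" "- x + d"] cov_kernel_minus[of a r "- e" "- x - d"]
      by (simp add: second_difference_def cov_kernel_minus add.commute)
    then show "\<forall>\<^sub>F x in at_top. second_difference (cov_kernel a r (- e)) d x = ?f (- x)"
      by simp
  qed (auto intro: eventually_mono[OF eventually_gt_at_top[of 0]])
  ultimately show ?thesis
    unfolding at_infinity_eq_at_top_bot asymp_equiv_def by (rule filterlim_sup)
qed

section \<open>Cross-covariances of increments\<close>

lemma gaussian_rv_square_integrable:
  assumes "prob_space M" "gaussian_rv M Y"
  shows "integrable M (\<lambda>\<omega>. (Y \<omega>)\<^sup>2)"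
proof -
  interpret prob_space M by fact
  have [measurable]: "Y \<in> borel_measurable M"
    using assms(2) by (simp add: gaussian_rv_def)
  consider (const) \<mu> where "AE \<omega> in M. Y \<omega> = \<mu>"
    | (normal) \<mu> \<sigma> where "0 < \<sigma>" "distributed M lborel Y (normal_density \<mu> \<sigma>)"
    using assms(2) by (auto simp: gaussian_rv_def)
  then show ?thesis
  proof cases
    case const
    then have "AE \<omega> in M. norm ((Y \<omega>)\<^sup>2) \<le> \<mu>\<^sup>2" by eventually_elim simp
    then show ?thesis by (intro integrable_const_bound) auto
  next
    case normal
    \<comment> \<open>The second moment from the central one: \<open>x\<^sup>2 = (x - \<mu>)\<^sup>2 + 2 \<mu> x - \<mu>\<^sup>2\<close>.\<close>
    have "integrable lborel (\<lambda>x. normal_density \<mu> \<sigma> x * (x - \<mu>) ^ 2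
        + 2 * \<mu> * (normal_density \<mu> \<sigma> x * x) - \<mu>\<^sup>2 * normal_density \<mu> \<sigma> x)"
      using normal(1) integrable_normal_moment[of \<sigma> \<mu> 2] integrable_normal_moment_nz_1[of \<sigma> \<mu>]
      by (intro Bochner_Integration.integrable_add Bochner_Integration.integrable_diff
          integrable_mult_right integrable_normal_density)
    also have "(\<lambda>x. normal_density \<mu> \<sigma> x * (x - \<mu>) ^ 2
        + 2 * \<mu> * (normal_density \<mu> \<sigma> x * x) - \<mu>\<^sup>2 * normal_density \<mu> \<sigma> x) =
        (\<lambda>x. normal_density \<mu> \<sigma> x * x\<^sup>2)"
      by (auto simp: power2_eq_square algebra_simps)
    finally show ?thesis
      using distributed_integrable[OF normal(2), of "\<lambda>x. x\<^sup>2"] by simp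
  qed
qed

lemma integrable_mult_of_square_integrable:
  fixes Y Z :: "'a \<Rightarrow> real"
  assumes [measurable]: "Y \<in> borel_measurable M" "Z \<in> borel_measurable M"
    and "integrable M (\<lambda>\<omega>. (Y \<omega>)\<^sup>2)" "integrable M (\<lambda>\<omega>. (Z \<omega>)\<^sup>2)"
  shows "integrable M (\<lambda>\<omega>. Y \<omega> * Z \<omega>)"
proof (rule Bochner_Integration.integrable_bound)
  show "integrable M (\<lambda>\<omega>. (Y \<omega>)\<^sup>2 + (Z \<omega>)\<^sup>2)" using assms by simp
  have "\<bar>x * y\<bar> \<le> x\<^sup>2 + y\<^sup>2" for x y :: real
    using sum_squares_bound[of "\<bar>x\<bar>" "\<bar>y\<bar>"] abs_ge_zero[of "x * y"]
    unfolding abs_mult power2_abs by linarith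
  then show "AE \<omega> in M. norm (Y \<omega> * Z \<omega>) \<le> norm ((Y \<omega>)\<^sup>2 + (Z \<omega>)\<^sup>2)" by simp
qed simp

lemma gaussian_process_integrable_mult:
  assumes "prob_space M" "gaussian_process M X"
  shows "integrable M (\<lambda>\<omega>. X s \<omega> $ k * X t \<omega> $ l)"
proof (rule integrable_mult_of_square_integrable)
  have gauss: "gaussian_rv M (\<lambda>\<omega>. X t \<omega> $ k)" for t k
  proof -
    have "gaussian_rv M (\<lambda>\<omega>. \<Sum>u\<in>{t}. axis k 1 \<bullet> X u \<omega>)"
      using assms(2) unfolding gaussian_process_def
      by (elim conjE allE[where x = "{t}"] allE[where x = "\<lambda>_. axis k 1"]) auto
    then show ?thesis by (simp add: inner_axis')
  qed
  then show "(\<lambda>\<omega>. X s \<omega> $ k) \<in> borel_measurable M" "(\<lambda>\<omega>. X t \<omega> $ l) \<in> borel_measurable M"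
    by (auto simp: gaussian_rv_def)
  show "integrable M (\<lambda>\<omega>. (X s \<omega> $ k)\<^sup>2)" "integrable M (\<lambda>\<omega>. (X t \<omega> $ l)\<^sup>2)"
    by (intro gaussian_rv_square_integrable assms gauss)+
qed

text \<open>
  Among the four products of the expansion, \<open>w(-s)\<close> occurs with both signs for each \<open>s\<close>, and so
  does \<open>w(t)\<close> for each \<open>t\<close>. The lags \<open>t - s\<close> are \<open>h\<close> twice, \<open>h + \<delta>\<close> and \<open>h - \<delta>\<close>.
\<close>

lemma incr_cross_cov_eq_second_difference:
  assumes int: "\<And>s t. integrable M (\<lambda>\<omega>. X s \<omega> $ i * X t \<omega> $ j)"
    and cov: "\<And>s t. prob_space.expectation M (\<lambda>\<omega>. X s \<omega> $ i * X t \<omega> $ j) =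
      c * (w (- s) + w t - w (t - s))"
  shows "incr_cross_cov M X i j t h \<delta> = c * second_difference w \<delta> h"
proof -
  have "incr_cross_cov M X i j t h \<delta> =
      (\<integral>\<omega>. X (t + \<delta>) \<omega> $ i * X (t + h + \<delta>) \<omega> $ j - X (t + \<delta>) \<omega> $ i * X (t + h) \<omega> $ j
        - X t \<omega> $ i * X (t + h + \<delta>) \<omega> $ j + X t \<omega> $ i * X (t + h) \<omega> $ j \<partial>M)"
    by (simp add: incr_cross_cov_def algebra_simps)
  also have "\<dots> = c * second_difference w \<delta> h"
    by (simp add: int cov second_difference_def algebra_simps)
  finally show ?thesis .
qed

text \<open>
  The kernel puts both regimes into the form required above; the term in \<open>s\<close> is the kernel at \<open>-s\<close>
  because both \<open>sgn s\<close> and \<open>s ln \<bar>s\<bar>\<close> are odd.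
\<close>

lemma mfBm_cov_eq_cov_kernel:
  fixes H :: "real ^ 'p" and i j :: 'p
  assumes "mfBm_cov_params M H X \<rho> \<eta> \<rho>' \<eta>'"
  defines "a \<equiv> H $ i + H $ j"
  defines "r \<equiv> (if a \<noteq> 1 then \<rho> i j else \<rho>' i j)"
  defines "e \<equiv> (if a \<noteq> 1 then \<eta> i j else \<eta>' i j)"
  shows "prob_space.expectation M (\<lambda>\<omega>. X s \<omega> $ i * X t \<omega> $ j) =
    mfBm_sd M X i * mfBm_sd M X j / 2 *
      (cov_kernel a r e (- s) + cov_kernel a r e t - cov_kernel a r e (t - s))"
proof (cases "a = 1")
  case True
  then have "prob_space.expectation M (\<lambda>\<omega>. X s \<omega> $ i * X t \<omega> $ j) =
      mfBm_sd M X i * mfBm_sd M X j / 2 *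
        (r * (\<bar>s\<bar> + \<bar>t\<bar> - \<bar>s - t\<bar>) + e * (t * ln \<bar>t\<bar> - s * ln \<bar>s\<bar> - (t - s) * ln \<bar>t - s\<bar>))"
    using assms(1)[unfolded mfBm_cov_params_def, THEN conjunct2, rule_format, of i j]
    by (auto simp: a_def r_def e_def)
  also have "r * (\<bar>s\<bar> + \<bar>t\<bar> - \<bar>s - t\<bar>) + e * (t * ln \<bar>t\<bar> - s * ln \<bar>s\<bar> - (t - s) * ln \<bar>t - s\<bar>) =
      cov_kernel a r e (- s) + cov_kernel a r e t - cov_kernel a r e (t - s)"
    unfolding cov_kernel_def using True abs_minus_commute[of s t]
    by (simp add: ring_distribs)
  finally show ?thesis .
next
  case False
  then have "prob_space.expectation M (\<lambda>\<omega>. X s \<omega> $ i * X t \<omega> $ j) =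
      mfBm_sd M X i * mfBm_sd M X j / 2 *
        ((r + e * sgn s) * \<bar>s\<bar> powr a + (r - e * sgn t) * \<bar>t\<bar> powr a
          - (r - e * sgn (t - s)) * \<bar>t - s\<bar> powr a)"
    using assms(1)[unfolded mfBm_cov_params_def, THEN conjunct1, rule_format, of i j]
    by (auto simp: a_def r_def e_def)
  then show ?thesis
    unfolding cov_kernel_def using False by (simp add: sgn_minus)
qed

theorem proposition4:
  fixes M :: "'a measure"
    and X :: "real \<Rightarrow> 'a \<Rightarrow> real ^ 'p"
    and H :: "real ^ 'p"
    and \<rho> \<eta> \<rho>' \<eta>' :: "'p \<Rightarrow> 'p \<Rightarrow> real"
    and i j :: 'p
    and \<delta> :: real
  assumes "mfBm M H X"
    and "\<And>k. mfBm_sd M X k > 0"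
    and "mfBm_cov_params M H X \<rho> \<eta> \<rho>' \<eta>'"
    and "\<delta> > 0"
  shows "(\<forall>t t' h. incr_cross_cov M X i j t h \<delta> = incr_cross_cov M X i j t' h \<delta>) \<and>
    (\<forall>t. (\<lambda>h. incr_cross_cov M X i j t h \<delta>) \<sim>[at_infinity]
      (\<lambda>h. mfBm_sd M X i * mfBm_sd M X j / 2 * \<delta>\<^sup>2 * \<bar>h\<bar> powr (H $ i + H $ j - 2)
            * kappa H \<rho> \<eta> \<eta>' i j (sgn h)))"
proof -
  define a where "a = H $ i + H $ j"
  define r where "r = (if a \<noteq> 1 then \<rho> i j else \<rho>' i j)"
  define e where "e = (if a \<noteq> 1 then \<eta> i j else \<eta>' i j)"
  define c where "c = mfBm_sd M X i * mfBm_sd M X j / 2"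
  have "prob_space M" "gaussian_process M X"
    using assms(1) by (auto simp: mfBm_def)
  then have cov: "incr_cross_cov M X i j t h \<delta> = c * second_difference (cov_kernel a r e) \<delta> h" for t h
    using mfBm_cov_eq_cov_kernel[OF assms(3), where i = i and j = j] unfolding a_def r_def e_def c_def
    by (rule incr_cross_cov_eq_second_difference[OF gaussian_process_integrable_mult])
  have "kappa H \<rho> \<eta> \<eta>' i j (sgn h) = cov_kernel_curvature a r (e * sgn h)" for h
    by (simp add: kappa_def cov_kernel_curvature_def a_def r_def e_def)
  moreover have "(\<lambda>h. c * second_difference (cov_kernel a r e) \<delta> h) \<sim>[at_infinity]
      (\<lambda>h. c * (\<delta>\<^sup>2 * \<bar>h\<bar> powr (a - 2) * cov_kernel_curvature a r (e * sgn h)))"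
    by (intro asymp_equiv_mult asymp_equiv_refl second_difference_cov_kernel_asymp_equiv assms)
  ultimately show ?thesis
    unfolding cov by (simp add: a_def c_def mult.assoc)
qed

end
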